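(* Let $P$ be a probability measure on $C^d([0,1])$ such that $P(t)$ is continuous for all $t\in[0,1]$, and let $ID$ be the integrated depth based on a multivariate depth function $D_d$ on $\mathbb R^d$ taking values in $[0,1]$. If $D_d$ fulfils $\mathrm{Asm}_2$ (with a given exponent $\beta\in(1/2,1]$) uniformly in the underlying probability distribution, then $ID$ satisfies $\mathrm{Asm}_2$ (with the same $\beta$) with respect to $P$. Respectively, if $D_d$ fulfils $\mathrm{Asm}_3$ uniformly in the underlying probability distribution, then $ID$ satisfies $\mathrm{Asm}_3$ with respect to $P$.
   Context: $C^d([0,1])$ is the space of continuous functions $[0,1]\to\mathbb R^d$. For a probability measure $P$ on $C^d([0,1])$ and $t\in[0,1]$, $P(t)$ is the distribution on $\mathbb R^d$ of $X(t)$ when $X\sim P$. Given a multivariate depth function $D_d$ (a map assigning to each $u\in\mathbb R^d$ and each probability measure on $\mathbb R^d$ a nonnegative number), the integrated depth is $$ID(x,P)=\int_0^1D_d(x(t),P(t))\,\mathrm dt,\qquad x\in C^d([0,1]),$$ and the sample version is $ID(x,\widehat P_m)$, with $\widehat P_m$ the empirical measure of i.i.d. $X_1,\dots,X_m\sim P$ (so $\widehat P_m(t)$ is the empirical measure of $X_1(t),\dots,X_m(t)$). For a depth function $D$ on a space $\Omega$ and a probability measure $P$ on $\Omega$ with i.i.d. sample $X_1,\dots,X_m$, empirical measure $\widehat P_m$, and $\widehat P_m^{-\{1\}}$ the empirical measure of $X_2,\dots,X_m$: $\mathrm{Asm}_2$ (with exponent $\beta\in(1/2,1]$): $\mathbb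 E\big(\sup_{x\in\Omega}|D(x,\widehat P_m)-D(x,P)|^{2\beta}\big)=O(m^{-\beta})$. $\mathrm{Asm}_3$: there exist a deterministic constant $C_{\det}$ and an index $m_0$ such that for every $m\ge m_0$, $\sup_{x\in\Omega}|D(x,\widehat P_m)-D(x,\widehat P_m^{-\{1\}})|\le C_{\det}/m$ almost surely. "Uniformly in the underlying probability distribution" means that the constants (the constant implied by $O(\cdot)$, respectively $C_{\det}$ and $m_0$) do not depend on the underlying (continuous) distribution on $\mathbb R^d$.
   Formalization: The depth D_d is additionally assumed jointly Borel measurable in the point u and the probability measure Q; without some measurability the integral defining ID need not exist. "Continuous" distribution is read as having no atoms. *)

theory Defs
  imports "HOL-Probability.Probability"
begin

text \<open>
  A depth function on a space \<open>\<Omega>\<close> has type \<open>'a \<Rightarrow> 'a measure \<Rightarrow> real\<close>; only its values at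
  probability measures matter.
\<close>

text \<open>Upper integral. The suprema in \<open>Asm2\<close> range over uncountable sets, so their measurability
  is not automatic; for a measurable integrand this is the ordinary expectation (next lemma).\<close>

definition outer_expectation :: "'a measure \<Rightarrow> ('a \<Rightarrow> ennreal) \<Rightarrow> ennreal" where
  "outer_expectation M f =
     Inf {\<integral>\<^sup>+ \<omega>. g \<omega> \<partial>M | g. g \<in> borel_measurable M \<and> (\<forall>\<omega>\<in>space M. f \<omega> \<le> g \<omega>)}"

lemma outer_expectation_measurable:
  assumes "f \<in> borel_measurable M"
  shows "outer_expectation M f = (\<integral>\<^sup>+ \<omega>. f \<omega> \<partial>M)"
  unfolding outer_expectation_def
proof (rule antisym)
  show "Inf {\<integral>\<^sup>+ \<omega>. g \<omega> \<partial>M | g. g \<in> borel_measurable M \<and> (\<forall>\<omega>\<in>space M. f \<omega> \<le> g \<omega>)}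
      \<le> (\<integral>\<^sup>+ \<omega>. f \<omega> \<partial>M)"
    using assms by (intro Inf_lower) auto
  show "(\<integral>\<^sup>+ \<omega>. f \<omega> \<partial>M)
      \<le> Inf {\<integral>\<^sup>+ \<omega>. g \<omega> \<partial>M | g. g \<in> borel_measurable M \<and> (\<forall>\<omega>\<in>space M. f \<omega> \<le> g \<omega>)}"
    by (intro Inf_greatest) (auto intro!: nn_integral_mono)
qed

text \<open>The i.i.d. sample \<open>X\<^sub>1, \<dots>, X\<^sub>m\<close> is realised as the coordinates of the \<open>m\<close>-fold product
  space.\<close>

definition sample_space :: "'a measure \<Rightarrow> nat \<Rightarrow> (nat \<Rightarrow> 'a) measure" where
  "sample_space P m = (\<Pi>\<^sub>M i\<in>{1..m}. P)"

text \<open>Empirical measure of the observations \<open>X i\<close>, \<open>i \<in> I\<close>, on the measurable space underlying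
  \<open>P\<close> (the measure \<open>P\<close> itself enters only through its space and sigma-algebra).\<close>

definition empirical :: "'a measure \<Rightarrow> nat set \<Rightarrow> (nat \<Rightarrow> 'a) \<Rightarrow> 'a measure" where
  "empirical P I X = distr (uniform_count_measure I) P X"

lemma emeasure_empirical:
  assumes "finite I" "X \<in> I \<rightarrow> space P" "A \<in> sets P"
  shows "emeasure (empirical P I X) A = ennreal (real (card {i\<in>I. X i \<in> A}) / real (card I))"
proof -
  have "X -` A \<inter> I = {i\<in>I. X i \<in> A}" by auto
  moreover have "X \<in> measurable (uniform_count_measure I) P"
    using assms(2) by (auto simp: measurable_def space_uniform_count_measure sets_uniform_count_measure)
  ultimately show ?thesis
    using assms
    by (simp add: empirical_def emeasure_distr space_uniform_count_measure
        emeasure_uniform_count_measure)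
qed

definition Asm2_bound ::
  "('a \<Rightarrow> 'a measure \<Rightarrow> real) \<Rightarrow> real \<Rightarrow> 'a measure \<Rightarrow> real \<Rightarrow> nat \<Rightarrow> bool" where
  "Asm2_bound D \<beta> P C m \<longleftrightarrow>
     outer_expectation (sample_space P m)
       (\<lambda>X. SUP x\<in>space P. ennreal (\<bar>D x (empirical P {1..m} X) - D x P\<bar> powr (2 * \<beta>)))
     \<le> ennreal (C * real m powr - \<beta>)"

definition Asm2 :: "('a \<Rightarrow> 'a measure \<Rightarrow> real) \<Rightarrow> real \<Rightarrow> 'a measure \<Rightarrow> bool" where
  "Asm2 D \<beta> P \<longleftrightarrow> (\<exists>C m0. \<forall>m\<ge>m0. Asm2_bound D \<beta> P C m)"

definition Asm2_uniform :: "('a \<Rightarrow> 'a measure \<Rightarrow> real) \<Rightarrow> real \<Rightarrow> 'a measure set \<Rightarrow> bool" where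
  "Asm2_uniform D \<beta> \<Q> \<longleftrightarrow> (\<exists>C m0. \<forall>Q\<in>\<Q>. \<forall>m\<ge>m0. Asm2_bound D \<beta> Q C m)"

definition Asm3_bound ::
  "('a \<Rightarrow> 'a measure \<Rightarrow> real) \<Rightarrow> 'a measure \<Rightarrow> real \<Rightarrow> nat \<Rightarrow> bool" where
  "Asm3_bound D P C m \<longleftrightarrow>
     (AE X in sample_space P m.
        (SUP x\<in>space P. ennreal \<bar>D x (empirical P {1..m} X) - D x (empirical P {2..m} X)\<bar>)
        \<le> ennreal (C / real m))"

definition Asm3 :: "('a \<Rightarrow> 'a measure \<Rightarrow> real) \<Rightarrow> 'a measure \<Rightarrow> bool" where
  "Asm3 D P \<longleftrightarrow> (\<exists>C m0. \<forall>m\<ge>m0. Asm3_bound D P C m)"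

definition Asm3_uniform :: "('a \<Rightarrow> 'a measure \<Rightarrow> real) \<Rightarrow> 'a measure set \<Rightarrow> bool" where
  "Asm3_uniform D \<Q> \<longleftrightarrow> (\<exists>C m0. \<forall>Q\<in>\<Q>. \<forall>m\<ge>m0. Asm3_bound D Q C m)"

text \<open>A continuous distribution on \<open>\<real>\<^sup>d\<close> is a probability measure without atoms.\<close>

definition continuous_distributions :: "(real ^ 'd) measure set" where
  "continuous_distributions =
     {Q \<in> space (prob_algebra borel). \<forall>u. emeasure Q {u} = 0}"

text \<open>Borel measurability in the pair \<open>(u, Q)\<close>, with the sigma-algebra on probability measures
  generated by the evaluations \<open>Q \<mapsto> Q A\<close>, is what makes the integrated depth well defined.\<close>

definition unit_depth :: "(real ^ 'd \<Rightarrow> (real ^ 'd) measure \<Rightarrow> real) \<Rightarrow> bool" where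
  "unit_depth D \<longleftrightarrow>
     (\<lambda>(u, Q). D u Q) \<in> borel_measurable (borel \<Otimes>\<^sub>M prob_algebra borel) \<and>
     (\<forall>u. \<forall>Q\<in>space (prob_algebra borel). D u Q \<in> {0..1})"

text \<open>\<open>C\<^sup>d([0,1])\<close>: continuous functions on \<open>[0,1]\<close> (with the value \<open>undefined\<close> outside, as in
  every \<open>Pi\<^sub>M\<close>). The sigma-algebra generated by the evaluations is the Borel sigma-algebra of the
  uniform norm.\<close>

definition path_space :: "(real \<Rightarrow> real ^ 'd) measure" where
  "path_space = restrict_space (\<Pi>\<^sub>M t\<in>{0..1}. borel) {x. continuous_on {0..1} x}"

definition marginal :: "(real \<Rightarrow> real ^ 'd) measure \<Rightarrow> real \<Rightarrow> (real ^ 'd) measure" where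
  "marginal P t = distr P borel (\<lambda>x. x t)"

definition integrated_depth ::
  "(real ^ 'd \<Rightarrow> (real ^ 'd) measure \<Rightarrow> real) \<Rightarrow>
   (real \<Rightarrow> real ^ 'd) \<Rightarrow> (real \<Rightarrow> real ^ 'd) measure \<Rightarrow> real" where
  "integrated_depth D x P = (LINT t:{0..1}|lborel. D (x t) (marginal P t))"

end

theory Submission
  imports Defs
begin

text \<open>
  Both bounds pass from \<open>D\<close> to \<open>integrated_depth D\<close> by integrating over \<open>t\<close>: by Jensen,
  \<open>|ID(x, P\<^sub>m) - ID(x, P)|\<close> to the power \<open>p \<ge> 1\<close> is at most the integral over \<open>t\<close> of
  \<open>\<phi>(t, X) = sup\<^sub>u |D(u, P\<^sub>m(t)) - D(u, P(t))|\<close> to the power \<open>p\<close>, which does not involve the path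
  \<open>x\<close>, and for each fixed \<open>t\<close> the hypothesis controls \<open>\<phi>(t, X)\<close>. Interchanging \<open>t\<close> and \<open>X\<close> needs
  joint measurability of \<open>\<phi>\<close>. A supremum over uncountably many \<open>u\<close> is not Borel in general, but its
  superlevel sets are projections of Borel sets. By the measurable projection theorem they lie in
  the completion, so \<open>\<phi>\<close> has a jointly measurable majorant that equals it almost everywhere, and
  Fubini applies to that majorant.
\<close>

section \<open>The Suslin operation and measurable projection\<close>

text \<open>Encodes families indexed by the finite sequences \<open>s 0, \<dots>, s n\<close>.\<close>

definition prefix_scheme :: "(nat \<Rightarrow> (nat \<Rightarrow> nat) \<Rightarrow> 'a) \<Rightarrow> bool" where
  "prefix_scheme K \<longleftrightarrow> (\<forall>n s t. (\<forall>i\<le>n. s i = t i) \<longrightarrow> K n s = K n t)"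

text \<open>Souslin's operation (A) applied to \<open>G\<close>. The class has countable unions and
  intersections, as shown below, but in general no complements.\<close>

definition suslin :: "'a set set \<Rightarrow> 'a set set" where
  "suslin G = {B. \<exists>K. prefix_scheme K \<and> (\<forall>n s. K n s \<in> G) \<and> B = (\<Union>s. \<Inter>n. K n s)}"

section \<open>Closure of the Suslin class under countable unions and intersections\<close>

lemma prefix_schemeD: "prefix_scheme K \<Longrightarrow> (\<And>i. i \<le> n \<Longrightarrow> s i = t i) \<Longrightarrow> K n s = K n t"
  unfolding prefix_scheme_def by blast

lemma suslinI:
  "prefix_scheme K \<Longrightarrow> (\<And>n s. K n s \<in> G) \<Longrightarrow> (\<Union>s. \<Inter>n. K n s) \<in> suslin G"
  unfolding suslin_def by blast

lemma suslinE:
  assumes "B \<in> suslin G"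
  obtains K where "prefix_scheme K" "\<And>n s. K n s \<in> G" "B = (\<Union>s. \<Inter>n. K n s)"
  using assms unfolding suslin_def by blast

lemma suslin_superset: "A \<in> G \<Longrightarrow> A \<in> suslin G"
  using suslinI[of "\<lambda>_ _. A" G] by (simp add: prefix_scheme_def)

lemma suslin_UN:
  assumes "\<And>k::nat. B k \<in> suslin G"
  shows "(\<Union>k. B k) \<in> suslin G"
proof -
  obtain K where K: "\<And>k. prefix_scheme (K k)" "\<And>k n s. K k n s \<in> G" "\<And>k. B k = (\<Union>s. \<Inter>n. K k n s)"
    using assms unfolding suslin_def by simp metis
  \<comment> \<open>The first entry of the branch encodes both \<open>k\<close> and the first entry of the branch for \<open>B k\<close>.\<close>
  define L where "L n s = K (fst (prod_decode (s 0))) n (s(0 := snd (prod_decode (s 0))))" for n s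
  have "prefix_scheme L"
    unfolding prefix_scheme_def L_def by (auto intro!: prefix_schemeD[OF K(1)])
  moreover have "(\<Union>k. B k) = (\<Union>s. \<Inter>n. L n s)"
  proof (rule set_eqI, rule iffI)
    fix x assume "x \<in> (\<Union>k. B k)"
    then obtain k s where "\<forall>n. x \<in> K k n s" using K(3) by auto
    then have "\<forall>n. x \<in> L n (s(0 := prod_encode (k, s 0)))" by (simp add: L_def)
    then show "x \<in> (\<Union>s. \<Inter>n. L n s)" by blast
  qed (auto simp: K(3) L_def)
  ultimately show ?thesis using suslinI[of L G] K(2) by (simp add: L_def)
qed

text \<open>Keeps the interleaving of branches below a prefix scheme: the first entries of branch
  \<open>k\<close>, up to index \<open>n\<close>, sit at positions not beyond
  \<open>prod_encode (k, n)\<close>.\<close>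

lemma prod_encode_mono_snd: "i \<le> j \<Longrightarrow> prod_encode (k, i) \<le> prod_encode (k, j)"
proof (induction rule: dec_induct)
  case (step j)
  then show ?case by (simp add: prod_encode_def)
qed simp

lemma suslin_INT:
  assumes "\<And>k::nat. B k \<in> suslin G"
  shows "(\<Inter>k. B k) \<in> suslin G"
proof -
  obtain K where K: "\<And>k. prefix_scheme (K k)" "\<And>k n s. K k n s \<in> G" "\<And>k. B k = (\<Union>s. \<Inter>n. K k n s)"
    using assms unfolding suslin_def by simp metis
  \<comment> \<open>A single branch interleaves branches for all \<open>k\<close>; condition \<open>n\<close> for \<open>B k\<close> is checked at
    \<open>N = prod_encode (k, n)\<close>, which bounds all the positions it reads.\<close>
  define L where
    "L N s = (case prod_decode N of (k, n) \<Rightarrow> K k n (\<lambda>j. s (prod_encode (k, j))))" for N s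
  have "L N s = L N t" if "\<forall>i\<le>N. s i = t i" for N s t
  proof -
    obtain k n where kn: "prod_decode N = (k, n)" by fastforce
    then have N: "N = prod_encode (k, n)" by (metis prod_decode_inverse)
    show ?thesis
      unfolding L_def kn using that
      by (auto intro!: prefix_schemeD[OF K(1)] simp: N prod_encode_mono_snd)
  qed
  then have "prefix_scheme L" unfolding prefix_scheme_def by blast
  moreover have "(\<Inter>k. B k) = (\<Union>s. \<Inter>n. L n s)"
  proof (rule set_eqI, rule iffI)
    fix x assume "x \<in> (\<Inter>k. B k)"
    then have "\<forall>k. \<exists>s. \<forall>n. x \<in> K k n s" by (auto simp: K(3))
    then obtain s where s: "\<And>k n. x \<in> K k n (s k)" by metis
    have "x \<in> L N (\<lambda>i. case prod_decode i of (k, j) \<Rightarrow> s k j)" for N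
      by (simp add: L_def s split: prod.split)
    then show "x \<in> (\<Union>s. \<Inter>n. L n s)" by blast
  next
    fix x assume "x \<in> (\<Union>s. \<Inter>n. L n s)"
    then obtain s where s: "\<And>N. x \<in> L N s" by blast
    have "x \<in> K k n (\<lambda>j. s (prod_encode (k, j)))" for k n
      using s[of "prod_encode (k, n)"] by (simp add: L_def)
    then show "x \<in> (\<Inter>k. B k)" unfolding K(3) by blast
  qed
  moreover have "L n s \<in> G" for n s by (simp add: L_def K(2) split: prod.split)
  ultimately show ?thesis using suslinI[of L G] by simp
qed

section \<open>Measurability of Suslin sets in the completion\<close>

text \<open>Koenig's lemma: only finitely many prefixes below \<open>N\<close> exist at each length.\<close>

lemma bounded_branch:
  fixes T :: "nat \<Rightarrow> (nat \<Rightarrow> nat) \<Rightarrow> bool"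
  assumes T: "prefix_scheme T"
    and fin: "\<And>j. \<exists>s. (\<forall>i\<le>j. s i \<le> N i) \<and> (\<forall>n\<le>j. T n s)"
  shows "\<exists>s. \<forall>n. T n s"
proof -
  define R where "R j s \<longleftrightarrow> (\<forall>i\<le>j. s i \<le> N i) \<and> (\<forall>n\<le>j. T n s)" for j s
  have R_mono: "R j s" if "R j' s" "j \<le> j'" for j j' s
    using that unfolding R_def by auto
  \<comment> \<open>The first \<open>k\<close> entries of \<open>p\<close> extend to bounded
    approximations of every depth \<open>j\<close>; the extension may depend on
    \<open>j\<close>.\<close>
  define good where "good k p \<longleftrightarrow> (\<forall>j. \<exists>s. (\<forall>i<k. s i = p i) \<and> R j s)" for k p
  have "\<exists>f. \<forall>k. good k (f k) \<and> (\<exists>v. f (Suc k) = (f k)(k := v))"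
  proof (rule dependent_nat_choice)
    show "\<exists>p. good 0 p" using fin by (auto simp: good_def R_def)
    fix p k assume p: "good k p"
    have "\<exists>v. good (Suc k) (p(k := v))"
    proof (rule ccontr)
      assume "\<not> ?thesis"
      then have "\<forall>v. \<exists>j. \<not> (\<exists>s. (\<forall>i<Suc k. s i = (p(k := v)) i) \<and> R j s)"
        unfolding good_def by simp
      from choice[OF this] obtain j
        where j: "\<forall>v. \<not> (\<exists>s. (\<forall>i<Suc k. s i = (p(k := v)) i) \<and> R (j v) s)" ..
      \<comment> \<open>If each value \<open>v\<close> at position \<open>k\<close> failed at its
        own depth \<open>j v\<close>, then depth \<open>J\<close> would refute all admissible
        \<open>v\<close> at once. The summand \<open>k\<close> forces
        \<open>s k \<le> N k\<close>.\<close>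
      define J where "J = k + (\<Sum>v\<le>N k. j v)"
      obtain s where s: "\<forall>i<k. s i = p i" "R J s"
        using p unfolding good_def by blast
      have "s k \<le> N k" using s(2) by (simp add: R_def J_def)
      then have "j (s k) \<le> (\<Sum>v\<le>N k. j v)" by (intro member_le_sum) auto
      then have "R (j (s k)) s" using R_mono[OF s(2)] by (simp add: J_def)
      moreover have "\<forall>i<Suc k. s i = (p(k := s k)) i" using s(1) by (simp add: less_Suc_eq)
      ultimately show False using j by blast
    qed
    then show "\<exists>q. good (Suc k) q \<and> (\<exists>v. q = p(k := v))" by blast
  qed
  then obtain f where f: "\<And>k. good k (f k)" "\<And>k. \<exists>v. f (Suc k) = (f k)(k := v)" by blast
  \<comment> \<open>Step \<open>k\<close> changes only entry \<open>k\<close>, so \<open>f k\<close>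
    agrees below \<open>k\<close> with the diagonal sequence.\<close>
  have eq: "f k i = f (Suc i) i" if "i < k" for i k
    using that
  proof (induction k)
    case (Suc k)
    then show ?case using f(2)[of k] by (cases "i = k") (auto simp: fun_upd_def)
  qed simp
  have "T n (\<lambda>i. f (Suc i) i)" for n
  proof -
    obtain s where s: "\<forall>i<Suc n. s i = f (Suc n) i" "R n s"
      using f(1)[of "Suc n"] unfolding good_def by blast
    have "T n s = T n (\<lambda>i. f (Suc i) i)"
    proof (rule prefix_schemeD[OF T])
      fix i assume "i \<le> n"
      then show "s i = f (Suc i) i" using s(1) eq[of i "Suc n"] by (metis less_Suc_eq_le)
    qed
    then show ?thesis using s(2) by (simp add: R_def)
  qed
  then show ?thesis by blast
qed

text \<open>Capacitability of Suslin sets. The sets \<open>Bd k N\<close> of points reached by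
  bounded branches need not be measurable, so the argument runs on the outer measure, which is
  continuous along increasing sequences of arbitrary subsets of the space.\<close>

lemma suslin_inner_approx:
  assumes "B \<in> suslin (sets M)" and c: "c < outer_measure_of M B" and fin: "finite_measure M"
  shows "\<exists>A\<in>sets M. A \<subseteq> B \<and> c \<le> emeasure M A"
proof -
  interpret finite_measure M by fact
  obtain K where K: "prefix_scheme K" "\<And>n s. K n s \<in> sets M" "B = (\<Union>s. \<Inter>n. K n s)"
    using assms(1) by (rule suslinE) blast
  \<comment> \<open>Bounding the entries of the branch one at a time, by continuity of the outer measure from
    below, loses arbitrarily little; bounded branches give measurable sets by Koenig's lemma.\<close>
  define Bd where "Bd k N = {x. \<exists>s. (\<forall>i<k. s i \<le> N i) \<and> (\<forall>n. x \<in> K n s)}" for k and N :: "nat \<Rightarrow> nat"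
  have Bd_sp: "Bd k N \<subseteq> space M" for k N
    using K(2)[THEN sets.sets_into_space] unfolding Bd_def by fast
  have "\<exists>f. \<forall>k. c < outer_measure_of M (Bd k (f k)) \<and> (\<exists>v. f (Suc k) = (f k)(k := v))"
  proof (rule dependent_nat_choice)
    have "Bd 0 N = B" for N by (auto simp: Bd_def K(3))
    then show "\<exists>N. c < outer_measure_of M (Bd 0 N)" using c by simp
    fix N k assume *: "c < outer_measure_of M (Bd k N)"
    have "incseq (\<lambda>v. Bd (Suc k) (N(k := v)))"
    proof (rule incseq_SucI, rule subsetI)
      fix v x assume "x \<in> Bd (Suc k) (N(k := v))"
      then obtain s where s: "\<forall>i<Suc k. s i \<le> (N(k := v)) i" "\<forall>n. x \<in> K n s"
        unfolding Bd_def by blast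
      have "\<forall>i<Suc k. s i \<le> (N(k := Suc v)) i"
        using s(1) by (auto simp: less_Suc_eq le_SucI)
      then show "x \<in> Bd (Suc k) (N(k := Suc v))" using s(2) unfolding Bd_def by blast
    qed
    then have "(SUP v. outer_measure_of M (Bd (Suc k) (N(k := v)))) =
        outer_measure_of M (\<Union>v. Bd (Suc k) (N(k := v)))"
      by (intro SUP_outer_measure_of_incseq Bd_sp)
    also have "(\<Union>v. Bd (Suc k) (N(k := v))) = Bd k N"
    proof (intro set_eqI iffI)
      fix x assume "x \<in> Bd k N"
      then obtain s where s: "\<forall>i<k. s i \<le> N i" "\<forall>n. x \<in> K n s" unfolding Bd_def by blast
      then have "x \<in> Bd (Suc k) (N(k := s k))" unfolding Bd_def by (auto simp: less_Suc_eq)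
      then show "x \<in> (\<Union>v. Bd (Suc k) (N(k := v)))" by blast
    next
      fix x assume "x \<in> (\<Union>v. Bd (Suc k) (N(k := v)))"
      then obtain v s where s: "\<forall>i<Suc k. s i \<le> (N(k := v)) i" "\<forall>n. x \<in> K n s"
        unfolding Bd_def by blast
      have "\<forall>i<k. s i \<le> N i" using s(1) by (auto simp: less_Suc_eq)
      then show "x \<in> Bd k N" using s(2) unfolding Bd_def by blast
    qed
    finally have "c < (SUP v. outer_measure_of M (Bd (Suc k) (N(k := v))))" using * by (simp only:)
    then show "\<exists>q. c < outer_measure_of M (Bd (Suc k) q) \<and> (\<exists>v. q = N(k := v))"
      unfolding less_SUP_iff by blast
  qed
  then obtain f where f: "\<And>k. c < outer_measure_of M (Bd k (f k))" "\<And>k. \<exists>v. f (Suc k) = (f k)(k := v)"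
    by blast
  define N where "N i = f (Suc i) i" for i
  have eq: "f k i = N i" if "i < k" for i k
    using that
  proof (induction k)
    case (Suc k)
    then show ?case using f(2)[of k] by (cases "i = k") (auto simp: N_def)
  qed simp
  \<comment> \<open>Setting the entries beyond \<open>j\<close> to 0 leaves finitely many
    \<open>s\<close>, so \<open>L j\<close> is measurable. Nothing is lost, because
    \<open>K n s\<close> with \<open>n \<le> j\<close> does not read those entries.\<close>
  define L where "L j = (\<Union>s\<in>PiE_dflt {..j} 0 (\<lambda>i. {..N i}). \<Inter>n\<in>{..j}. K n s)" for j
  have L_iff: "x \<in> L j \<longleftrightarrow> (\<exists>s. (\<forall>i\<le>j. s i \<le> N i) \<and> (\<forall>n\<le>j. x \<in> K n s))" for x j
  proof
    assume "\<exists>s. (\<forall>i\<le>j. s i \<le> N i) \<and> (\<forall>n\<le>j. x \<in> K n s)"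
    then obtain s where s: "\<forall>i\<le>j. s i \<le> N i" "\<forall>n\<le>j. x \<in> K n s" by blast
    define t where "t i = (if i \<le> j then s i else 0)" for i
    have "K n s = K n t" if "n \<le> j" for n
      by (rule prefix_schemeD[OF K(1)]) (use that in \<open>auto simp: t_def\<close>)
    moreover have "t \<in> PiE_dflt {..j} 0 (\<lambda>i. {..N i})"
      using s(1) by (auto simp: PiE_dflt_def t_def)
    ultimately show "x \<in> L j" using s(2) unfolding L_def by (intro UN_I[of t]) auto
  next
    assume "x \<in> L j"
    then obtain s where "s \<in> PiE_dflt {..j} 0 (\<lambda>i. {..N i})" "\<forall>n\<le>j. x \<in> K n s"
      unfolding L_def by auto
    then show "\<exists>s. (\<forall>i\<le>j. s i \<le> N i) \<and> (\<forall>n\<le>j. x \<in> K n s)"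
      by (intro exI[of _ s]) (auto simp: PiE_dflt_def)
  qed
  have L_sets: "L j \<in> sets M" for j
    unfolding L_def by (intro sets.finite_UN sets.finite_INT K(2) finite_PiE_dflt) auto
  have "decseq L"
  proof (rule decseq_SucI, rule subsetI)
    fix j x assume "x \<in> L (Suc j)"
    then obtain s where "\<forall>i\<le>Suc j. s i \<le> N i" "\<forall>n\<le>Suc j. x \<in> K n s"
      unfolding L_iff by blast
    then show "x \<in> L j" unfolding L_iff by (intro exI[of _ s]) auto
  qed
  have "c \<le> emeasure M (L j)" for j
  proof -
    have "Bd (Suc j) (f (Suc j)) \<subseteq> L j"
    proof
      fix x assume "x \<in> Bd (Suc j) (f (Suc j))"
      then obtain s where "\<forall>i<Suc j. s i \<le> f (Suc j) i" "\<forall>n. x \<in> K n s"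
        unfolding Bd_def by blast
      then show "x \<in> L j" unfolding L_iff by (intro exI[of _ s]) (auto simp: eq)
    qed
    then have "outer_measure_of M (Bd (Suc j) (f (Suc j))) \<le> emeasure M (L j)"
      using outer_measure_of_mono[of _ "L j" M] L_sets by auto
    then show ?thesis using f(1)[of "Suc j"] by simp
  qed
  then have "c \<le> (INF j. emeasure M (L j))" by (rule INF_greatest)
  \<comment> \<open>Continuity from above; this is where the measure has to be finite.\<close>
  also have "\<dots> = emeasure M (\<Inter>j. L j)"
    using L_sets \<open>decseq L\<close> by (intro INF_emeasure_decseq) auto
  finally have "c \<le> emeasure M (\<Inter>j. L j)" .
  moreover have "(\<Inter>j. L j) \<subseteq> B"
  proof
    fix x assume "x \<in> (\<Inter>j. L j)"
    then have "\<exists>s. (\<forall>i\<le>j. s i \<le> N i) \<and> (\<forall>n\<le>j. x \<in> K n s)" for j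
      unfolding L_iff[symmetric] by blast
    moreover have "prefix_scheme (\<lambda>n s. x \<in> K n s)"
      unfolding prefix_scheme_def using prefix_schemeD[OF K(1)] by blast
    ultimately have "\<exists>s. \<forall>n. x \<in> K n s"
      by (intro bounded_branch[where N = N])
    then show "x \<in> B" by (auto simp: K(3))
  qed
  ultimately show ?thesis using L_sets by (intro bexI[of _ "\<Inter>j. L j"]) auto
qed

text \<open>Inner approximation yields countably many measurable subsets whose union
  \<open>U\<close> has the measure of a measurable hull \<open>E\<close>. Hence \<open>B\<close>
  differs from \<open>U\<close> by a subset of the null set \<open>E - U\<close>.\<close>

theorem suslin_sets_completion:
  assumes B: "B \<in> suslin (sets M)" and fin: "finite_measure M"
  shows "B \<in> sets (completion M)"
proof -
  interpret finite_measure M by fact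
  let ?I = "{A \<in> sets M. A \<subseteq> B}"
  obtain K where "prefix_scheme K" and K: "\<And>n s. K n s \<in> sets M" "B = (\<Union>s. \<Inter>n. K n s)"
    using B by (rule suslinE) blast
  have sp: "B \<subseteq> space M"
    unfolding K(2) using sets.sets_into_space[OF K(1)] by (intro UN_least) (rule INF_lower2[OF UNIV_I])
  obtain E where E: "E \<in> sets M" "B \<subseteq> E" "outer_measure_of M B = emeasure M E"
    using outer_measure_of_attain[OF sp] by metis
  have le: "emeasure M E \<le> (SUP A\<in>?I. emeasure M A)"
  proof (rule dense_le)
    fix c assume "c < emeasure M E"
    then obtain A where "A \<in> ?I" "c \<le> emeasure M A"
      using suslin_inner_approx[OF B _ fin, of c] E(3) by auto
    then show "c \<le> (SUP A\<in>?I. emeasure M A)" by (rule SUP_upper2)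
  qed
  have "?I \<noteq> {}" by blast
  then obtain f :: "nat \<Rightarrow> ennreal" where f: "range f \<subseteq> emeasure M ` ?I" "(SUP A\<in>?I. emeasure M A) = (SUP i. f i)"
    using ennreal_SUP_countable_SUP[of ?I "emeasure M"] by blast
  have "\<forall>i. \<exists>A. A \<in> ?I \<and> f i = emeasure M A" using f(1) by blast
  from choice[OF this] obtain A where A: "\<And>i. A i \<in> ?I" "\<And>i. f i = emeasure M (A i)" by blast
  define U where "U = (\<Union>i. A i)"
  have U: "U \<in> sets M" "U \<subseteq> B" using A(1) by (auto simp: U_def intro!: sets.countable_UN)
  have "(SUP i. f i) \<le> emeasure M U"
    unfolding A(2) using A(1) U(1) by (intro SUP_least emeasure_mono) (auto simp: U_def)
  then have "emeasure M E \<le> emeasure M U" using le unfolding f(2) by order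
  moreover have "emeasure M U \<le> emeasure M E" using U E by (intro emeasure_mono) auto
  ultimately have "emeasure M (E - U) = 0"
    using U E by (simp add: emeasure_Diff subset_trans[OF U(2) E(2)])
  then have "E - U \<in> null_sets M" using U E by auto
  then show ?thesis
    using U E by (intro sets_completionI[of B U "B - U" "E - U"]) auto
qed

section \<open>Projections of product-measurable sets\<close>

text \<open>The sets that are Suslin together with their complement form a sigma-algebra, and it
  contains the rectangles with a closed second side. Compact sides suffice as a basis because closed
  and open sets of a Euclidean space are countable unions of compact sets.\<close>

lemma sets_pair_suslin_rectangles:
  fixes B :: "('a \<times> 'b::euclidean_space) set"
  assumes "B \<in> sets (M \<Otimes>\<^sub>M borel)"
  shows "B \<in> suslin {a \<times> C | a C. a \<in> sets M \<and> compact C}"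
proof -
  let ?R = "{a \<times> C | a C. a \<in> sets M \<and> compact (C :: 'b set)}"
  let ?\<Omega> = "space M \<times> (UNIV :: 'b set)"
  let ?E = "{a \<times> b | a b. a \<in> sets M \<and> b \<in> Collect (closed :: 'b set \<Rightarrow> bool)}"
  have compact_UN: "a \<times> (\<Union>n::nat. C n) \<in> suslin ?R" if "a \<in> sets M" "\<And>n. compact (C n)" for a C
  proof -
    have "(\<Union>n. a \<times> C n) \<in> suslin ?R"
      using that by (intro suslin_UN suslin_superset) auto
    also have "(\<Union>n. a \<times> C n) = a \<times> (\<Union>n. C n)" by blast
    finally show ?thesis .
  qed
  have closed_R: "a \<times> b \<in> suslin ?R" if "a \<in> sets M" "closed b" for a b
  proof -
    have "b = (\<Union>n::nat. b \<inter> cball 0 (real n))"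
      by (auto simp: real_arch_simple)
    moreover have "a \<times> (\<Union>n::nat. b \<inter> cball 0 (real n)) \<in> suslin ?R"
      using that by (intro compact_UN closed_Int_compact) auto
    ultimately show ?thesis by simp
  qed
  have open_R: "a \<times> b \<in> suslin ?R" if "a \<in> sets M" "open b" for a b
  proof -
    obtain C where C: "\<And>n::nat. compact (C n)" "\<Union>(range C) = b"
      using open_Union_compact_subsets[OF \<open>open b\<close>] by metis
    show ?thesis using compact_UN[OF \<open>a \<in> sets M\<close>, of C] C by simp
  qed
  have "sets (M \<Otimes>\<^sub>M borel) = sets (sigma ?\<Omega> ?E)"
    using sets_pair_eq[of "sets M" M "{space M}" "Collect closed" "borel :: 'b measure" "{UNIV}"]
      sets.space_closed[of M] by (simp add: sets.sigma_sets_eq borel_eq_closed)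
  then have "B \<in> sigma_sets ?\<Omega> ?E"
    using assms sets.sets_into_space by (subst (asm) sets_measure_of) fastforce+
  then have "B \<in> suslin ?R \<and> ?\<Omega> - B \<in> suslin ?R"
  proof induction
    case (Basic A)
    then obtain a b where ab: "A = a \<times> b" "a \<in> sets M" "closed b" by blast
    \<comment> \<open>The complement of a rectangle splits into two rectangles, written as a
      countable union: index 0 misses \<open>a\<close>, every other index misses
      \<open>b\<close>.\<close>
    have "(\<Union>n::nat. if n = 0 then (space M - a) \<times> UNIV else a \<times> (- b)) \<in> suslin ?R"
      using ab by (intro suslin_UN) (auto intro!: closed_R open_R)
    also have "(\<Union>n::nat. if n = 0 then (space M - a) \<times> UNIV else a \<times> (- b)) = ?\<Omega> - A"
      using ab sets.sets_into_space[OF ab(2)] by (auto split: if_splits)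
    finally show ?case using ab closed_R by auto
  next
    case Empty
    show ?case using closed_R[of "{}" "{}"] closed_R[of "space M" UNIV] by simp
  next
    case (Compl A)
    have "A \<subseteq> ?\<Omega>"
      using Compl(1) sets.sets_into_space[of _ M] by (intro sigma_sets_into_sp[of ?E]) fastforce+
    then have "?\<Omega> - (?\<Omega> - A) = A" by blast
    then show ?case using Compl(2) by simp
  next
    case (Union A)
    have "?\<Omega> - (\<Union>i. A i) = (\<Inter>i. ?\<Omega> - A i)" by blast
    then show ?case using Union(2) suslin_UN[of A] suslin_INT[of "\<lambda>i. ?\<Omega> - A i"] by simp
  qed
  then show ?thesis by blast
qed

text \<open>Projection commutes with the union over branches but not with the intersection along a
  branch; compactness of the second sides repairs this.\<close>

lemma suslin_fst_image:
  fixes B :: "('a \<times> 'b::t2_space) set"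
  assumes "B \<in> suslin {a \<times> C | a C. a \<in> sets M \<and> compact C}"
  shows "fst ` B \<in> suslin (sets M)"
proof -
  obtain K where K: "prefix_scheme K" "\<And>n s. K n s \<in> {a \<times> C | a C. a \<in> sets M \<and> compact C}"
      "B = (\<Union>s. \<Inter>n. K n s)"
    using assms by (rule suslinE) blast
  define A where "A n s = fst ` K n s" for n s
  define C where "C n s = snd ` K n s" for n s
  \<comment> \<open>Reading the sides off as images, instead of choosing them, lets them inherit the
    prefix property of \<open>K\<close>. An empty rectangle gets two empty sides, which are still
    measurable and compact.\<close>
  have rect: "fst ` R \<in> sets M \<and> compact (snd ` R) \<and> R = fst ` R \<times> snd ` R"
    if "R \<in> {a \<times> C | a C. a \<in> sets M \<and> compact C}" for R :: "('a \<times> 'b) set"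
    using that by (auto simp: fst_image_times snd_image_times)
  have AC: "A n s \<in> sets M" "compact (C n s)" "K n s = A n s \<times> C n s" for n s
    using rect[OF K(2)] by (auto simp: A_def C_def)
  \<comment> \<open>By compactness, a point common to all \<open>C n s\<close> exists iff all finite intersections are nonempty,
    which removes the quantifier over the second coordinate.\<close>
  define L where "L n s = (if (\<Inter>i\<le>n. C i s) = {} then {} else A n s)" for n s
  have "L n s = L n t" if *: "\<forall>i\<le>n. s i = t i" for n s t
  proof -
    have "K i s = K i t" if "i \<le> n" for i
      by (rule prefix_schemeD[OF K(1)]) (use * that in auto)
    then show ?thesis by (simp add: L_def A_def C_def)
  qed
  then have "prefix_scheme L" unfolding prefix_scheme_def by blast
  moreover have "L n s \<in> sets M" for n s by (simp add: L_def AC)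
  moreover have "fst ` B = (\<Union>s. \<Inter>n. L n s)"
  proof (intro set_eqI iffI)
    fix x assume "x \<in> fst ` B"
    then obtain y s where "\<forall>n. (x, y) \<in> K n s" unfolding K(3) by auto
    then have "\<forall>n. x \<in> A n s \<and> y \<in> C n s" by (simp add: AC(3))
    then have "\<forall>n. x \<in> L n s" by (auto simp: L_def)
    then show "x \<in> (\<Union>s. \<Inter>n. L n s)" by blast
  next
    fix x assume "x \<in> (\<Union>s. \<Inter>n. L n s)"
    then obtain s where s: "\<And>n. x \<in> L n s" by blast
    have x: "x \<in> A n s" and ne: "(\<Inter>i\<le>n. C i s) \<noteq> {}" for n
      using s[of n] by (auto simp: L_def split: if_splits)
    have "C 0 s \<inter> (\<Inter>n\<in>UNIV. C n s) \<noteq> {}"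
    proof (rule compact_imp_fip_image)
      fix I :: "nat set" assume "finite I"
      \<comment> \<open>Inserting 0 makes the maximum well defined when \<open>I\<close> is
        empty.\<close>
      then have "I \<subseteq> {..Max (insert 0 I)}" by auto
      then have "(\<Inter>i\<le>Max (insert 0 I). C i s) \<subseteq> C 0 s \<inter> (\<Inter>i\<in>I. C i s)" by blast
      then show "C 0 s \<inter> (\<Inter>i\<in>I. C i s) \<noteq> {}" using ne by blast
    qed (use AC(2) compact_imp_closed in auto)
    then obtain y where "\<forall>n. y \<in> C n s" by blast
    then have "(x, y) \<in> B" unfolding K(3) AC(3) using x by blast
    then show "x \<in> fst ` B" by force
  qed
  ultimately show ?thesis using suslinI[of L "sets M"] by simp
qed

text \<open>The completion cannot be dropped: the projection of a Borel set is analytic but need not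
  be Borel.\<close>

theorem measurable_projection:
  fixes B :: "('a \<times> 'b::euclidean_space) set"
  assumes "B \<in> sets (M \<Otimes>\<^sub>M borel)" "finite_measure M"
  shows "fst ` B \<in> sets (completion M)"
  using assms sets_pair_suslin_rectangles suslin_fst_image suslin_sets_completion by blast

section \<open>Suprema over an uncountable parameter\<close>

text \<open>Strict superlevel sets are used because the supremum exceeds \<open>c\<close> exactly
  when some \<open>f x u\<close> does, so that the set is a projection.\<close>

lemma borel_measurable_completion_SUP:
  fixes f :: "'a \<Rightarrow> 'b::euclidean_space \<Rightarrow> ennreal"
  assumes f: "(\<lambda>(x, u). f x u) \<in> borel_measurable (M \<Otimes>\<^sub>M borel)" and "finite_measure M"
  shows "(\<lambda>x. SUP u. f x u) \<in> borel_measurable (completion M)"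
proof (rule borel_measurableI_greater)
  fix c :: ennreal
  let ?B = "{z \<in> space (M \<Otimes>\<^sub>M (borel :: 'b measure)). c < (case z of (x, u) \<Rightarrow> f x u)}"
  have "?B \<in> sets (M \<Otimes>\<^sub>M borel)" using f by measurable
  then have "fst ` ?B \<in> sets (completion M)" using assms(2) by (rule measurable_projection)
  also have "fst ` ?B = {x \<in> space (completion M). c < (SUP u. f x u)}"
    by (force simp: less_SUP_iff space_pair_measure)
  finally show "{x \<in> space (completion M). c < (SUP u. f x u)} \<in> sets (completion M)" .
qed

text \<open>A measurable version of the supremum is raised to \<top> on a null set containing all
  points of disagreement. It then dominates everywhere and stays equal to the supremum almost
  everywhere.\<close>

lemma SUP_measurable_majorant:
  fixes f :: "'a \<Rightarrow> 'b::euclidean_space \<Rightarrow> ennreal"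
  assumes "(\<lambda>(x, u). f x u) \<in> borel_measurable (M \<Otimes>\<^sub>M borel)" and "finite_measure M"
  obtains g where "g \<in> borel_measurable M" "\<And>x u. x \<in> space M \<Longrightarrow> f x u \<le> g x"
    "AE x in M. g x = (SUP u. f x u)"
proof -
  obtain h where h: "h \<in> borel_measurable M" "AE x in M. (SUP u. f x u) = h x"
    using completion_ex_borel_measurable[OF borel_measurable_completion_SUP[OF assms]] by blast
  then obtain N where N: "{x \<in> space M. (SUP u. f x u) \<noteq> h x} \<subseteq> N" "N \<in> null_sets M"
    by (auto elim!: AE_E simp: null_sets_def)
  show thesis
  proof (rule that)
    show "(\<lambda>x. if x \<in> N then \<top> else h x) \<in> borel_measurable M"
      using h(1) N(2) by (intro measurable_If_set) auto
    show "f x u \<le> (if x \<in> N then \<top> else h x)" if "x \<in> space M" for x u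
    proof (cases "x \<in> N")
      case False
      then have "(SUP u. f x u) = h x" using N(1) that by blast
      then show ?thesis using False by (metis (mono_tags, lifting) SUP_upper UNIV_I)
    qed simp
    show "AE x in M. (if x \<in> N then \<top> else h x) = (SUP u. f x u)"
      using AE_not_in[OF N(2)] h(2) by eventually_elim simp
  qed
qed

section \<open>Paths, marginals and samples\<close>

abbreviation unit_lborel :: "real measure" where
  "unit_lborel \<equiv> restrict_space lborel {0..1}"

lemma prob_space_unit_lborel: "prob_space unit_lborel"
  by (rule prob_spaceI) (simp add: space_restrict_space emeasure_restrict_space)

lemma space_unit_lborel: "space unit_lborel = {0..1}"
  by (simp add: space_restrict_space)

section \<open>Jensen's inequality for powers\<close>

text \<open>A convex function lies above its tangent at \<open>c\<close>. At \<open>y = 0\<close>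
  the claim is checked directly, as it reduces to \<open>(1 - p) * c powr p \<le> 0\<close>.\<close>

lemma powr_tangent:
  fixes c y p :: real
  assumes "0 < c" "0 \<le> y" "1 \<le> p"
  shows "c powr p + p * c powr (p - 1) * (y - c) \<le> y powr p"
proof (cases "y = 0")
  case True
  have "c powr (p - 1) * c = c powr p" using \<open>0 < c\<close> by (simp add: powr_diff)
  then have "c powr p + p * c powr (p - 1) * (y - c) = (1 - p) * c powr p"
    by (simp add: True algebra_simps)
  also have "\<dots> \<le> 0" using assms by (simp add: mult_nonpos_nonneg)
  finally show ?thesis by (simp add: True)
next
  case False
  have "y powr p - c powr p \<ge> p * c powr (p - 1) * (y - c)"
    by (rule convex_on_imp_above_tangent[OF powr_convex[OF assms(3)]])
      (use assms False in \<open>auto simp: interior_open intro!: derivative_eq_intros\<close>)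
  then show ?thesis by simp
qed

text \<open>Integrate the tangent at \<open>c\<close>, the absolute value of the mean: its linear
  part contributes a nonnegative amount since \<open>c\<close> is at most the mean of
  \<bar>\<open>f\<close>\<bar>. A zero mean is split off because the tangent needs
  \<open>0 < c\<close>.\<close>

lemma (in prob_space) powr_integral_le:
  fixes f :: "'a \<Rightarrow> real"
  assumes [measurable]: "f \<in> borel_measurable M" and bd: "\<And>x. x \<in> space M \<Longrightarrow> \<bar>f x\<bar> \<le> 1" and p: "1 \<le> p"
  shows "ennreal (\<bar>\<integral>x. f x \<partial>M\<bar> powr p) \<le> (\<integral>\<^sup>+x. ennreal (\<bar>f x\<bar> powr p) \<partial>M)"
proof (cases "(\<integral>x. f x \<partial>M) = 0")
  case False
  define c where "c = \<bar>\<integral>x. f x \<partial>M\<bar>"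
  have c: "0 < c" using False by (simp add: c_def)
  have int: "integrable M f" by (rule integrable_const_bound[where B = 1]) (auto simp: bd)
  have "\<bar>f x\<bar> powr p \<le> 1" if "x \<in> space M" for x
    using powr_mono2[of p "\<bar>f x\<bar>" 1] bd[OF that] p by simp
  note le1 = this
  have intp: "integrable M (\<lambda>x. \<bar>f x\<bar> powr p)"
    by (rule integrable_const_bound[where B = 1]) (auto intro!: AE_I2 simp: le1)
  have "c \<le> (\<integral>x. \<bar>f x\<bar> \<partial>M)" unfolding c_def by (rule integral_abs_bound)
  then have "c powr p \<le> c powr p + p * c powr (p - 1) * ((\<integral>x. \<bar>f x\<bar> \<partial>M) - c)"
    using p by simp
  also have "\<dots> = (\<integral>x. c powr p + p * c powr (p - 1) * (\<bar>f x\<bar> - c) \<partial>M)"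
    using int by (simp add: prob_space)
  also have "\<dots> \<le> (\<integral>x. \<bar>f x\<bar> powr p \<partial>M)"
    using int intp c p by (intro integral_mono powr_tangent) auto
  finally have "ennreal (c powr p) \<le> ennreal (\<integral>x. \<bar>f x\<bar> powr p \<partial>M)" by (rule ennreal_leI)
  also have "\<dots> = (\<integral>\<^sup>+x. ennreal (\<bar>f x\<bar> powr p) \<partial>M)"
    by (rule nn_integral_eq_integral[symmetric, OF intp]) simp
  finally show ?thesis by (simp add: c_def)
qed simp

section \<open>Path space and joint measurability of evaluation\<close>

lemma space_path_space:
  "space path_space = {x \<in> extensional {0..1}. continuous_on {0..1} x}"
  by (simp add: path_space_def space_restrict_space space_PiM PiE_def Int_def conj_commute)

lemma measurable_path_component: "t \<in> {0..1} \<Longrightarrow> (\<lambda>x. x t) \<in> path_space \<rightarrow>\<^sub>M borel"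
  unfolding path_space_def by (intro measurable_restrict_space1 measurable_component_singleton)

lemma floor_grid_tendsto:
  fixes t :: real
  assumes "0 \<le> t"
  shows "(\<lambda>n. real (nat \<lfloor>real (Suc n) * t\<rfloor>) / real (Suc n)) \<longlonglongrightarrow> t"
  proof (rule tendsto_sandwich)
    show "(\<lambda>n. t - 1 / real (Suc n)) \<longlonglongrightarrow> t"
      using tendsto_diff[OF tendsto_const LIMSEQ_Suc[OF lim_1_over_n], of t] by simp
    have *: "real (nat \<lfloor>real (Suc n) * t\<rfloor>) = of_int \<lfloor>real (Suc n) * t\<rfloor>" for n
      using assms by simp
    show "\<forall>\<^sub>F n in sequentially. t - 1 / real (Suc n) \<le> real (nat \<lfloor>real (Suc n) * t\<rfloor>) / real (Suc n)"
    proof (intro always_eventually allI)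
      fix n
      have "real (Suc n) * t - 1 \<le> of_int \<lfloor>real (Suc n) * t\<rfloor>" by linarith
      then have "(real (Suc n) * t - 1) / real (Suc n) \<le> of_int \<lfloor>real (Suc n) * t\<rfloor> / real (Suc n)"
        by (rule divide_right_mono) simp
      then show "t - 1 / real (Suc n) \<le> real (nat \<lfloor>real (Suc n) * t\<rfloor>) / real (Suc n)"
        unfolding * by (simp add: diff_divide_distrib del: of_nat_Suc)
    qed
    show "\<forall>\<^sub>F n in sequentially. real (nat \<lfloor>real (Suc n) * t\<rfloor>) / real (Suc n) \<le> t"
    proof (intro always_eventually allI)
      fix n
      have "of_int \<lfloor>real (Suc n) * t\<rfloor> \<le> real (Suc n) * t" by linarith
      then have "of_int \<lfloor>real (Suc n) * t\<rfloor> / real (Suc n) \<le> real (Suc n) * t / real (Suc n)"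
        by (rule divide_right_mono) simp
      then show "real (nat \<lfloor>real (Suc n) * t\<rfloor>) / real (Suc n) \<le> t"
        unfolding * by (simp del: of_nat_Suc)
    qed
  qed simp

text \<open>By continuity of the paths, evaluation at \<open>t\<close> is the limit of evaluations
  at grid points approaching \<open>t\<close>. For fixed \<open>n\<close> the grid point ranges over
  a countable set, which reduces joint measurability to that of single evaluations.\<close>

lemma measurable_path_eval:
  "(\<lambda>(t, x). x t) \<in> unit_lborel \<Otimes>\<^sub>M path_space \<rightarrow>\<^sub>M (borel :: (real ^ 'd) measure)"
proof (rule borel_measurable_LIMSEQ_metric)
  let ?g = "\<lambda>n t :: real. nat \<lfloor>real (Suc n) * t\<rfloor>"
  fix n
  \<comment> \<open>The cap at 1 keeps the grid point in the unit interval for every natural index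
    \<open>i\<close>, also those beyond \<open>Suc n\<close>; only there is evaluation known to be
    measurable.\<close>
  show "(\<lambda>z. snd z (min 1 (real (?g n (fst z)) / real (Suc n))))
      \<in> borel_measurable (unit_lborel \<Otimes>\<^sub>M path_space)"
  proof (rule measurable_compose_countable[where f = "\<lambda>i z. snd z (min 1 (real i / real (Suc n)))"])
    show "(\<lambda>z. snd z (min 1 (real i / real (Suc n)))) \<in> borel_measurable (unit_lborel \<Otimes>\<^sub>M path_space)" for i
      by (intro measurable_compose[OF measurable_snd measurable_path_component]) simp
    have "?g n \<in> borel \<rightarrow>\<^sub>M count_space UNIV"
      by measurable
    then have "?g n \<in> unit_lborel \<rightarrow>\<^sub>M count_space UNIV"
      by (intro measurable_restrict_space1) simp
    then show "(\<lambda>z. ?g n (fst z)) \<in> unit_lborel \<Otimes>\<^sub>M path_space \<rightarrow>\<^sub>M count_space UNIV"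
      by (rule measurable_compose[OF measurable_fst])
  qed
next
  fix z :: "real \<times> (real \<Rightarrow> real ^ 'd)" assume "z \<in> space (unit_lborel \<Otimes>\<^sub>M path_space)"
  then obtain t x where z: "z = (t, x)" "t \<in> {0..1}" "continuous_on {0..1} x"
    by (auto simp: space_pair_measure space_unit_lborel space_path_space)
  have "(\<lambda>n. min 1 (real (nat \<lfloor>real (Suc n) * t\<rfloor>) / real (Suc n))) \<longlonglongrightarrow> min 1 t"
    using z(2) by (intro tendsto_min tendsto_const floor_grid_tendsto) simp
  moreover have "min 1 (real (nat \<lfloor>real (Suc n) * t\<rfloor>) / real (Suc n)) \<in> {0..1}" for n
    by simp
  ultimately have "(\<lambda>n. x (min 1 (real (nat \<lfloor>real (Suc n) * t\<rfloor>) / real (Suc n)))) \<longlonglongrightarrow> x t"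
    using z(2) by (intro continuous_on_tendsto_compose[OF z(3)] always_eventually) auto
  then show "(\<lambda>n. snd z (min 1 (real (nat \<lfloor>real (Suc n) * fst z\<rfloor>) / real (Suc n))))
      \<longlonglongrightarrow> (case z of (t, x) \<Rightarrow> x t)"
    by (simp only: z(1) fst_conv snd_conv case_prod_conv)
qed

section \<open>Depth along a path\<close>

lemma measurable_depth_path:
  assumes D: "unit_depth D" and \<mu>: "\<mu> \<in> unit_lborel \<rightarrow>\<^sub>M prob_algebra borel" and x: "x \<in> space path_space"
  shows "(\<lambda>t. D (x t) (\<mu> t)) \<in> borel_measurable unit_lborel"
proof -
  have "(\<lambda>t. (t, x)) \<in> unit_lborel \<rightarrow>\<^sub>M unit_lborel \<Otimes>\<^sub>M path_space"
    using x by (rule measurable_Pair2')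
  from measurable_compose[OF this measurable_path_eval]
  have "x \<in> unit_lborel \<rightarrow>\<^sub>M borel" by simp
  then have "(\<lambda>t. (x t, \<mu> t)) \<in> unit_lborel \<rightarrow>\<^sub>M borel \<Otimes>\<^sub>M prob_algebra borel"
    using \<mu> by (rule measurable_Pair)
  moreover have "(\<lambda>(u, Q). D u Q) \<in> borel_measurable (borel \<Otimes>\<^sub>M prob_algebra borel)"
    using D by (simp add: unit_depth_def)
  ultimately have "(\<lambda>t. (\<lambda>(u, Q). D u Q) (x t, \<mu> t)) \<in> borel_measurable unit_lborel"
    by (rule measurable_compose)
  then show ?thesis by simp
qed

lemma measurable_depth_difference:
  assumes D: "unit_depth D" and "\<mu> \<in> N \<rightarrow>\<^sub>M prob_algebra borel" "\<nu> \<in> N \<rightarrow>\<^sub>M prob_algebra borel"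
  shows "(\<lambda>(z, u). ennreal (\<bar>D u (\<mu> z) - D u (\<nu> z)\<bar> powr p)) \<in> borel_measurable (N \<Otimes>\<^sub>M borel)"
proof -
  have D': "(\<lambda>(u, Q). D u Q) \<in> borel_measurable (borel \<Otimes>\<^sub>M prob_algebra borel)"
    using D by (simp add: unit_depth_def)
  have *: "(\<lambda>z. D (snd z) (\<kappa> (fst z))) \<in> borel_measurable (N \<Otimes>\<^sub>M borel)"
    if "\<kappa> \<in> N \<rightarrow>\<^sub>M prob_algebra borel" for \<kappa>
    using measurable_compose[OF measurable_Pair[OF measurable_snd measurable_compose[OF measurable_fst that]] D']
    by simp
  note [measurable] = *[OF assms(2)] *[OF assms(3)]
  show ?thesis unfolding case_prod_beta by measurable
qed

text \<open>Stated for measurable families of distributions, so that one application compares the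
  sample with \<open>P\<close> and another compares the full with the reduced sample.\<close>

lemma integral_depth_difference_le:
  assumes D: "unit_depth D" and p: "1 \<le> p" and x: "x \<in> space path_space"
    and \<mu>: "\<mu> \<in> unit_lborel \<rightarrow>\<^sub>M prob_algebra borel" and \<nu>: "\<nu> \<in> unit_lborel \<rightarrow>\<^sub>M prob_algebra borel"
  shows "ennreal (\<bar>(LINT t|unit_lborel. D (x t) (\<mu> t)) - (LINT t|unit_lborel. D (x t) (\<nu> t))\<bar> powr p)
    \<le> (\<integral>\<^sup>+t. ennreal (\<bar>D (x t) (\<mu> t) - D (x t) (\<nu> t)\<bar> powr p) \<partial>unit_lborel)"
proof -
  interpret prob_space unit_lborel by (rule prob_space_unit_lborel)
  have bd: "D (x t) (\<kappa> t) \<in> {0..1}"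
    if "\<kappa> \<in> unit_lborel \<rightarrow>\<^sub>M prob_algebra borel" "t \<in> space unit_lborel" for \<kappa> t
    using D measurable_space[OF that] by (simp add: unit_depth_def)
  note meas = measurable_depth_path[OF D _ x]
  have int: "integrable unit_lborel (\<lambda>t. D (x t) (\<kappa> t))" if "\<kappa> \<in> unit_lborel \<rightarrow>\<^sub>M prob_algebra borel" for \<kappa>
  proof (rule integrable_const_bound[where B = 1])
    show "AE t in unit_lborel. norm (D (x t) (\<kappa> t)) \<le> 1"
      using bd[OF that] by (intro AE_I2) force
  qed (rule meas[OF that])
  have "ennreal (\<bar>LINT t|unit_lborel. D (x t) (\<mu> t) - D (x t) (\<nu> t)\<bar> powr p)
    \<le> (\<integral>\<^sup>+t. ennreal (\<bar>D (x t) (\<mu> t) - D (x t) (\<nu> t)\<bar> powr p) \<partial>unit_lborel)"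
  proof (rule powr_integral_le[OF _ _ p])
    show "(\<lambda>t. D (x t) (\<mu> t) - D (x t) (\<nu> t)) \<in> borel_measurable unit_lborel"
      by (intro borel_measurable_diff meas \<mu> \<nu>)
    show "\<bar>D (x t) (\<mu> t) - D (x t) (\<nu> t)\<bar> \<le> 1" if "t \<in> space unit_lborel" for t
      using bd[OF \<mu> that] bd[OF \<nu> that] by auto
  qed
  then show ?thesis by (simp only: Bochner_Integration.integral_diff[OF int[OF \<mu>] int[OF \<nu>]])
qed

lemma integrated_depth_unit_lborel:
  "integrated_depth D x P = (LINT t|unit_lborel. D (x t) (marginal P t))"
  unfolding integrated_depth_def set_lebesgue_integral_def by (subst integral_restrict_space) auto

section \<open>Marginals of empirical measures and of samples\<close>

lemma measurable_marginal:
  assumes "P \<in> space (prob_algebra path_space)"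
  shows "marginal P \<in> unit_lborel \<rightarrow>\<^sub>M prob_algebra borel"
  unfolding marginal_def
  using measurable_distr_prob_space2[OF measurable_const[OF assms] measurable_path_eval] .

lemma uniform_count_measure_in_prob_algebra:
  "finite I \<Longrightarrow> I \<noteq> {} \<Longrightarrow> uniform_count_measure I \<in> space (prob_algebra (count_space I))"
  by (simp add: space_prob_algebra prob_space_uniform_count_measure sets_uniform_count_measure)

lemma marginal_empirical:
  assumes "sets P = sets path_space" "t \<in> {0..1}" "X \<in> I \<rightarrow> space P"
  shows "marginal (empirical P I X) t = distr (uniform_count_measure I) borel (\<lambda>i. X i t)"
proof -
  have "X \<in> uniform_count_measure I \<rightarrow>\<^sub>M P"
    using assms(3) by (auto simp: measurable_def space_uniform_count_measure sets_uniform_count_measure)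
  moreover have "(\<lambda>x. x t) \<in> P \<rightarrow>\<^sub>M borel"
    using measurable_path_component[OF assms(2)] by (simp add: measurable_cong_sets[OF assms(1) refl])
  ultimately show ?thesis unfolding marginal_def empirical_def by (simp add: distr_distr comp_def)
qed

lemma sets_marginal: "sets (marginal P t) = sets borel"
  by (simp add: marginal_def)

text \<open>The evaluated sample is extensional on \<open>J\<close>, the index set of the whole
  sample, while \<open>I\<close> may be smaller: the reduced sample drops the first
  observation.\<close>

lemma empirical_marginal:
  assumes "I \<subseteq> J"
  shows "empirical (marginal P t) I (compose J (\<lambda>x. x t) X) = distr (uniform_count_measure I) borel (\<lambda>i. X i t)"
  unfolding empirical_def using assms
  by (intro distr_cong) (auto simp: sets_marginal space_uniform_count_measure compose_def)

text \<open>The marginal is the image of a fixed probability measure on \<open>I\<close> under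
  \<open>i \<mapsto> X i t\<close>, and this map is jointly measurable in \<open>t\<close>,
  \<open>X\<close> and \<open>i\<close> because \<open>I\<close> is finite.\<close>

lemma measurable_marginal_empirical:
  assumes P: "sets P = sets path_space" and I: "finite I" "I \<noteq> {}" "I \<subseteq> {1..m}"
  shows "(\<lambda>(t, X). marginal (empirical P I X) t)
    \<in> unit_lborel \<Otimes>\<^sub>M sample_space P m \<rightarrow>\<^sub>M prob_algebra borel"
proof -
  let ?N = "unit_lborel \<Otimes>\<^sub>M sample_space P m"
  have comp: "(\<lambda>z. snd z i (fst z)) \<in> ?N \<rightarrow>\<^sub>M borel" if "i \<in> I" for i
  proof -
    have "(\<lambda>X. X i) \<in> sample_space P m \<rightarrow>\<^sub>M path_space"
      using that I measurable_component_singleton[of i "{1..m}" "\<lambda>_. P"]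
      by (auto simp: sample_space_def measurable_cong_sets[OF refl P])
    from measurable_compose[OF measurable_Pair[OF measurable_fst measurable_compose[OF measurable_snd this]] measurable_path_eval]
    show ?thesis by simp
  qed
  have "(\<lambda>(z, i). snd z i (fst z)) \<in> ?N \<Otimes>\<^sub>M count_space I \<rightarrow>\<^sub>M borel"
    using I(1) comp unfolding case_prod_beta
    by (intro measurable_compose_countable'[where g = snd and I = I and f = "\<lambda>i w. snd (fst w) i (fst (fst w))"]
        measurable_compose[OF measurable_fst comp]) (auto intro: countable_finite)
  then have "(\<lambda>z. distr (uniform_count_measure I) borel (\<lambda>i. snd z i (fst z))) \<in> ?N \<rightarrow>\<^sub>M prob_algebra borel"
    by (rule measurable_distr_prob_space2[OF measurable_const[OF uniform_count_measure_in_prob_algebra[OF I(1,2)]]])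
  moreover have "(case z of (t, X) \<Rightarrow> marginal (empirical P I X) t)
      = distr (uniform_count_measure I) borel (\<lambda>i. snd z i (fst z))" if "z \<in> space ?N" for z
  proof -
    obtain t X where z: "z = (t, X)" by (cases z)
    have "t \<in> {0..1}" "X \<in> {1..m} \<rightarrow> space P"
      using that unfolding z
      by (auto simp: space_pair_measure space_unit_lborel sample_space_def space_PiM PiE_iff)
    moreover from this have "X \<in> I \<rightarrow> space P" using I(3) by blast
    ultimately show ?thesis using marginal_empirical[OF P] by (simp add: z)
  qed
  ultimately show ?thesis by (simp cong: measurable_cong)
qed

lemma prob_space_sample_space: "prob_space P \<Longrightarrow> prob_space (sample_space P m)"
  unfolding sample_space_def by (rule prob_space_PiM)

text \<open>Evaluating i.i.d. paths at \<open>t\<close> gives an i.i.d. sample from the marginal,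
  which transports the hypotheses on \<open>D\<close> to samples of paths.\<close>

lemma distr_sample_space_marginal:
  assumes P: "P \<in> space (prob_algebra path_space)" and t: "t \<in> {0..1}"
  shows "compose {1..m} (\<lambda>x. x t) \<in> sample_space P m \<rightarrow>\<^sub>M sample_space (marginal P t) m"
    and "distr (sample_space P m) (sample_space (marginal P t) m) (compose {1..m} (\<lambda>x. x t))
      = sample_space (marginal P t) m"
proof -
  have setsP: "sets P = sets path_space" and "prob_space P"
    using P by (auto simp: space_prob_algebra)
  then interpret prob_space P by simp
  have ev: "(\<lambda>x. x t) \<in> P \<rightarrow>\<^sub>M borel"
    using measurable_path_component[OF t] by (simp add: measurable_cong_sets[OF setsP refl])
  then have ev': "(\<lambda>x. x t) \<in> P \<rightarrow>\<^sub>M marginal P t"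
    by (simp add: measurable_cong_sets[OF refl sets_marginal])
  show "compose {1..m} (\<lambda>x. x t) \<in> sample_space P m \<rightarrow>\<^sub>M sample_space (marginal P t) m"
    unfolding sample_space_def compose_def
    by (intro measurable_restrict measurable_compose[OF _ ev'] measurable_component_singleton)
  have pm: "prob_space (marginal P t)" unfolding marginal_def by (rule prob_space_distr[OF ev])
  have "distr P (marginal P t) (\<lambda>x. x t) = marginal P t"
    unfolding marginal_def by (intro distr_cong) auto
  then show "distr (sample_space P m) (sample_space (marginal P t) m) (compose {1..m} (\<lambda>x. x t))
      = sample_space (marginal P t) m"
    unfolding sample_space_def
    using distr_PiM_finite_prob_space'[of "{1..m}" "\<lambda>_. P" "\<lambda>_. marginal P t" "\<lambda>x. x t"]
      pm ev' prob_space_axioms by simp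
qed

section \<open>Integrated depth\<close>

text \<open>The common core of both transfers. Equality with the supremum holds almost everywhere,
  which suffices to invoke the hypotheses on \<open>D\<close>; the bound for paths holds for every
  sample, as \<open>outer_expectation\<close> demands of a majorant.\<close>

lemma integrated_depth_majorant:
  fixes D :: "real ^ 'd \<Rightarrow> (real ^ 'd) measure \<Rightarrow> real"
  assumes D: "unit_depth D" and S: "prob_space S" and p: "1 \<le> p"
    and \<mu>: "(\<lambda>(t, X). \<mu> X t) \<in> unit_lborel \<Otimes>\<^sub>M S \<rightarrow>\<^sub>M prob_algebra borel"
    and \<nu>: "(\<lambda>(t, X). \<nu> X t) \<in> unit_lborel \<Otimes>\<^sub>M S \<rightarrow>\<^sub>M prob_algebra borel"
  obtains \<psi> where "\<psi> \<in> borel_measurable (unit_lborel \<Otimes>\<^sub>M S)"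
    "AE t in unit_lborel. AE X in S. \<psi> (t, X) = (SUP u. ennreal (\<bar>D u (\<mu> X t) - D u (\<nu> X t)\<bar> powr p))"
    "\<And>X x. X \<in> space S \<Longrightarrow> x \<in> space path_space \<Longrightarrow>
      ennreal (\<bar>(LINT t|unit_lborel. D (x t) (\<mu> X t)) - (LINT t|unit_lborel. D (x t) (\<nu> X t))\<bar> powr p)
      \<le> (\<integral>\<^sup>+t. \<psi> (t, X) \<partial>unit_lborel)"
proof -
  interpret S: prob_space S by fact
  interpret T: prob_space unit_lborel by (rule prob_space_unit_lborel)
  interpret TS: pair_prob_space unit_lborel S ..
  obtain \<psi> where \<psi>: "\<psi> \<in> borel_measurable (unit_lborel \<Otimes>\<^sub>M S)"
      "\<And>z u. z \<in> space (unit_lborel \<Otimes>\<^sub>M S) \<Longrightarrow>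
        ennreal (\<bar>D u (case z of (t, X) \<Rightarrow> \<mu> X t) - D u (case z of (t, X) \<Rightarrow> \<nu> X t)\<bar> powr p) \<le> \<psi> z"
      "AE z in unit_lborel \<Otimes>\<^sub>M S. \<psi> z =
        (SUP u. ennreal (\<bar>D u (case z of (t, X) \<Rightarrow> \<mu> X t) - D u (case z of (t, X) \<Rightarrow> \<nu> X t)\<bar> powr p))"
    using SUP_measurable_majorant[OF measurable_depth_difference[OF D \<mu> \<nu>, of p] TS.P.finite_measure_axioms]
    by blast
  show thesis
  proof (rule that)
    show "\<psi> \<in> borel_measurable (unit_lborel \<Otimes>\<^sub>M S)" by fact
    show "AE t in unit_lborel. AE X in S. \<psi> (t, X) = (SUP u. ennreal (\<bar>D u (\<mu> X t) - D u (\<nu> X t)\<bar> powr p))"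
      using TS.AE_pair[OF \<psi>(3)] by simp
    fix X and x :: "real \<Rightarrow> real ^ 'd" assume X: "X \<in> space S" and x: "x \<in> space path_space"
    have "(\<lambda>t. (t, X)) \<in> unit_lborel \<rightarrow>\<^sub>M unit_lborel \<Otimes>\<^sub>M S"
      using X by (rule measurable_Pair2')
    note sect = measurable_compose[OF this]
    have "\<mu> X \<in> unit_lborel \<rightarrow>\<^sub>M prob_algebra borel" "\<nu> X \<in> unit_lborel \<rightarrow>\<^sub>M prob_algebra borel"
      using sect[OF \<mu>] sect[OF \<nu>] by simp_all
    then have "ennreal (\<bar>(LINT t|unit_lborel. D (x t) (\<mu> X t)) - (LINT t|unit_lborel. D (x t) (\<nu> X t))\<bar> powr p)
        \<le> (\<integral>\<^sup>+t. ennreal (\<bar>D (x t) (\<mu> X t) - D (x t) (\<nu> X t)\<bar> powr p) \<partial>unit_lborel)"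
      by (rule integral_depth_difference_le[OF D p x])
    also have "\<dots> \<le> (\<integral>\<^sup>+t. \<psi> (t, X) \<partial>unit_lborel)"
      using \<psi>(2)[of "(_, X)"] X by (intro nn_integral_mono) (simp add: space_pair_measure)
    finally show "ennreal (\<bar>(LINT t|unit_lborel. D (x t) (\<mu> X t)) - (LINT t|unit_lborel. D (x t) (\<nu> X t))\<bar> powr p)
      \<le> (\<integral>\<^sup>+t. \<psi> (t, X) \<partial>unit_lborel)" .
  qed
qed

text \<open>Every measurable majorant \<open>g\<close> of \<open>h\<close> pulls back along
  \<open>T\<close> to an almost sure majorant of \<open>\<psi>\<close> with the same integral. Since
  \<open>h\<close> itself is never integrated, it may be nonmeasurable.\<close>

lemma nn_integral_le_outer_expectation_distr:
  assumes T: "T \<in> S \<rightarrow>\<^sub>M S'" "distr S S' T = S'" and le: "AE X in S. \<psi> X \<le> h (T X)"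
  shows "(\<integral>\<^sup>+X. \<psi> X \<partial>S) \<le> outer_expectation S' h"
  unfolding outer_expectation_def
proof (rule Inf_greatest, clarify)
  fix g assume g: "g \<in> borel_measurable S'" "\<forall>\<omega>\<in>space S'. h \<omega> \<le> g \<omega>"
  have "AE X in S. \<psi> X \<le> g (T X)"
    using le AE_space
  proof eventually_elim
    case (elim X)
    then show ?case using g(2) measurable_space[OF T(1)] order_trans by blast
  qed
  then have "(\<integral>\<^sup>+X. \<psi> X \<partial>S) \<le> (\<integral>\<^sup>+X. g (T X) \<partial>S)" by (rule nn_integral_mono_AE)
  also have "\<dots> = integral\<^sup>N (distr S S' T) g"
    using T(1) g(1) by (subst nn_integral_distr) simp_all
  finally show "(\<integral>\<^sup>+X. \<psi> X \<partial>S) \<le> integral\<^sup>N S' g" by (simp only: T(2))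
qed

text \<open>Both sides are the image of the uniform measure on \<open>I\<close> under
  \<open>i \<mapsto> X i t\<close>.\<close>

lemma marginal_empirical_compose:
  assumes P: "sets P = sets path_space" and "t \<in> {0..1}" "I \<subseteq> {1..m}" "X \<in> space (sample_space P m)"
  shows "marginal (empirical P I X) t = empirical (marginal P t) I (compose {1..m} (\<lambda>x. x t) X)"
proof -
  have "X \<in> {1..m} \<rightarrow> space P"
    using assms(4) by (auto simp: sample_space_def space_PiM PiE_iff)
  then have "X \<in> I \<rightarrow> space P" using assms(3) by blast
  then show ?thesis unfolding empirical_marginal[OF assms(3)] by (rule marginal_empirical[OF P assms(2)])
qed

section \<open>Transfer of the two bounds\<close>

text \<open>The same \<open>C\<close> serves all \<open>t\<close>, and it survives integration over
  \<open>t\<close> unchanged because the unit interval has mass one.\<close>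

lemma Asm2_bound_integrated_depth:
  fixes D :: "real ^ 'd \<Rightarrow> (real ^ 'd) measure \<Rightarrow> real"
  assumes D: "unit_depth D" and P: "P \<in> space (prob_algebra path_space)"
    and \<beta>: "1 / 2 \<le> \<beta>" and m: "1 \<le> m"
    and bound: "\<And>t. t \<in> {0..1} \<Longrightarrow> Asm2_bound D \<beta> (marginal P t) C m"
  shows "Asm2_bound (integrated_depth D) \<beta> P C m"
proof -
  define S where "S = sample_space P m"
  have setsP: "sets P = sets path_space" and "prob_space P"
    using P by (auto simp: space_prob_algebra)
  interpret S: prob_space S
    unfolding S_def by (rule prob_space_sample_space) fact
  interpret T: prob_space unit_lborel by (rule prob_space_unit_lborel)
  interpret TS: pair_prob_space unit_lborel S ..
  have \<mu>: "(\<lambda>(t, X). marginal (empirical P {1..m} X) t) \<in> unit_lborel \<Otimes>\<^sub>M S \<rightarrow>\<^sub>M prob_algebra borel"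
    unfolding S_def by (rule measurable_marginal_empirical[OF setsP]) (use m in auto)
  have \<nu>: "(\<lambda>(t, X). marginal P t) \<in> unit_lborel \<Otimes>\<^sub>M S \<rightarrow>\<^sub>M prob_algebra borel"
    using measurable_compose[OF measurable_fst measurable_marginal[OF P]] by (simp add: case_prod_beta')
  \<comment> \<open>The exponent has to be at least 1 for Jensen's inequality.\<close>
  have "1 \<le> 2 * \<beta>" using \<beta> by simp
  from integrated_depth_majorant[OF D S.prob_space_axioms this \<mu> \<nu>]
  obtain \<psi> where \<psi>: "\<psi> \<in> borel_measurable (unit_lborel \<Otimes>\<^sub>M S)"
    "AE t in unit_lborel. AE X in S. \<psi> (t, X) =
      (SUP u. ennreal (\<bar>D u (marginal (empirical P {1..m} X) t) - D u (marginal P t)\<bar> powr (2 * \<beta>)))"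
    "\<And>X x. X \<in> space S \<Longrightarrow> x \<in> space path_space \<Longrightarrow>
      ennreal (\<bar>integrated_depth D x (empirical P {1..m} X) - integrated_depth D x P\<bar> powr (2 * \<beta>))
      \<le> (\<integral>\<^sup>+t. \<psi> (t, X) \<partial>unit_lborel)"
    unfolding integrated_depth_unit_lborel[symmetric] by blast
  let ?h = "\<lambda>t Y. SUP u\<in>space (marginal P t).
    ennreal (\<bar>D u (empirical (marginal P t) {1..m} Y) - D u (marginal P t)\<bar> powr (2 * \<beta>))"
  \<comment> \<open>The majorant integrated over \<open>t\<close> is measurable in \<open>X\<close>
    and bounds every path, so it competes in the infimum defining the upper integral.\<close>
  have "outer_expectation S (\<lambda>X. SUP x\<in>space P.
      ennreal (\<bar>integrated_depth D x (empirical P {1..m} X) - integrated_depth D x P\<bar> powr (2 * \<beta>)))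
    \<le> (\<integral>\<^sup>+X. (\<integral>\<^sup>+t. \<psi> (t, X) \<partial>unit_lborel) \<partial>S)"
    unfolding outer_expectation_def
  proof (rule Inf_lower, rule CollectI, intro exI conjI ballI)
    show "(\<lambda>X. \<integral>\<^sup>+t. \<psi> (t, X) \<partial>unit_lborel) \<in> borel_measurable S"
      using T.borel_measurable_nn_integral_fst[OF measurable_pair_swap[OF \<psi>(1)]] by simp
    show "(SUP x\<in>space P. ennreal (\<bar>integrated_depth D x (empirical P {1..m} X) - integrated_depth D x P\<bar> powr (2 * \<beta>)))
        \<le> (\<integral>\<^sup>+t. \<psi> (t, X) \<partial>unit_lborel)" if "X \<in> space S" for X
      using \<psi>(3)[OF that] by (intro SUP_least) (simp add: sets_eq_imp_space_eq[OF setsP])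
  qed simp
  \<comment> \<open>Tonelli: with \<open>t\<close> outside, the hypothesis applies to each marginal
    separately.\<close>
  also have "\<dots> = (\<integral>\<^sup>+t. (\<integral>\<^sup>+X. \<psi> (t, X) \<partial>S) \<partial>unit_lborel)"
    by (rule TS.Fubini[OF \<psi>(1)])
  also have "\<dots> \<le> (\<integral>\<^sup>+t. ennreal (C * real m powr - \<beta>) \<partial>unit_lborel)"
  proof (rule nn_integral_mono_AE)
    show "AE t in unit_lborel. (\<integral>\<^sup>+X. \<psi> (t, X) \<partial>S) \<le> ennreal (C * real m powr - \<beta>)"
      using \<psi>(2) AE_space
    proof eventually_elim
      case (elim t)
      then have t: "t \<in> {0..1}" by (simp add: space_unit_lborel)
      have "AE X in S. \<psi> (t, X) \<le> ?h t (compose {1..m} (\<lambda>x. x t) X)"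
        using elim(1) AE_space
      proof eventually_elim
        case (elim X)
        then show ?case
          using marginal_empirical_compose[OF setsP t subset_refl, of X m] by (simp add: S_def marginal_def)
      qed
      then have "(\<integral>\<^sup>+X. \<psi> (t, X) \<partial>S) \<le> outer_expectation (sample_space (marginal P t) m) (?h t)"
        unfolding S_def
        by (rule nn_integral_le_outer_expectation_distr[OF distr_sample_space_marginal[OF P t]])
      also have "\<dots> \<le> ennreal (C * real m powr - \<beta>)"
        using bound[OF t] by (simp only: Asm2_bound_def)
      finally show ?case .
    qed
  qed
  also have "\<dots> = ennreal (C * real m powr - \<beta>)"
    using T.emeasure_space_1 by simp
  finally show ?thesis by (simp only: Asm2_bound_def S_def)
qed

text \<open>For each \<open>t\<close> the bound fails on a null set of samples that depends on
  \<open>t\<close>. Fubini for null sets exchanges the quantifiers: almost every sample satisfies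
  the bound for almost every \<open>t\<close>, and integrating over \<open>t\<close> finishes the
  proof.\<close>

lemma Asm3_bound_integrated_depth:
  fixes D :: "real ^ 'd \<Rightarrow> (real ^ 'd) measure \<Rightarrow> real"
  assumes D: "unit_depth D" and P: "P \<in> space (prob_algebra path_space)" and m: "2 \<le> m"
    and bound: "\<And>t. t \<in> {0..1} \<Longrightarrow> Asm3_bound D (marginal P t) C m"
  shows "Asm3_bound (integrated_depth D) P C m"
proof -
  define S where "S = sample_space P m"
  have setsP: "sets P = sets path_space" and "prob_space P"
    using P by (auto simp: space_prob_algebra)
  interpret S: prob_space S
    unfolding S_def by (rule prob_space_sample_space) fact
  interpret T: prob_space unit_lborel by (rule prob_space_unit_lborel)
  interpret TS: pair_prob_space unit_lborel S ..
  have \<mu>: "(\<lambda>(t, X). marginal (empirical P {1..m} X) t) \<in> unit_lborel \<Otimes>\<^sub>M S \<rightarrow>\<^sub>M prob_algebra borel"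
    and \<nu>: "(\<lambda>(t, X). marginal (empirical P {2..m} X) t) \<in> unit_lborel \<Otimes>\<^sub>M S \<rightarrow>\<^sub>M prob_algebra borel"
    unfolding S_def by (rule measurable_marginal_empirical[OF setsP]; use m in auto)+
  \<comment> \<open>Exponent 1 turns Jensen's inequality into the triangle inequality for
    integrals.\<close>
  from integrated_depth_majorant[OF D S.prob_space_axioms order_refl \<mu> \<nu>]
  obtain \<psi> where \<psi>: "\<psi> \<in> borel_measurable (unit_lborel \<Otimes>\<^sub>M S)"
    "AE t in unit_lborel. AE X in S. \<psi> (t, X) =
      (SUP u. ennreal (\<bar>D u (marginal (empirical P {1..m} X) t) - D u (marginal (empirical P {2..m} X) t)\<bar> powr 1))"
    "\<And>X x. X \<in> space S \<Longrightarrow> x \<in> space path_space \<Longrightarrow>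
      ennreal (\<bar>integrated_depth D x (empirical P {1..m} X) - integrated_depth D x (empirical P {2..m} X)\<bar> powr 1)
      \<le> (\<integral>\<^sup>+t. \<psi> (t, X) \<partial>unit_lborel)"
    unfolding integrated_depth_unit_lborel[symmetric] by blast
  have "AE t in unit_lborel. AE X in S. \<psi> (t, X) \<le> ennreal (C / real m)"
    using \<psi>(2) AE_space
  proof eventually_elim
    case (elim t)
    then have t: "t \<in> {0..1}" by (simp add: space_unit_lborel)
    note push = distr_sample_space_marginal[OF P t, of m]
    have "AE Y in distr (sample_space P m) (sample_space (marginal P t) m) (compose {1..m} (\<lambda>x. x t)).
        (SUP u\<in>space (marginal P t).
          ennreal \<bar>D u (empirical (marginal P t) {1..m} Y) - D u (empirical (marginal P t) {2..m} Y)\<bar>)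
        \<le> ennreal (C / real m)"
      using bound[OF t] by (simp only: Asm3_bound_def push(2))
    from AE_distrD[OF push(1) this] have "AE X in S.
        (SUP u\<in>space (marginal P t).
          ennreal \<bar>D u (empirical (marginal P t) {1..m} (compose {1..m} (\<lambda>x. x t) X))
            - D u (empirical (marginal P t) {2..m} (compose {1..m} (\<lambda>x. x t) X))\<bar>)
        \<le> ennreal (C / real m)"
      by (simp only: S_def)
    with elim(1) AE_space show ?case
    proof eventually_elim
      case (elim X)
      have "{2..m} \<subseteq> {1..m}" by auto
      with elim show ?case
        using marginal_empirical_compose[OF setsP t subset_refl, of X m] marginal_empirical_compose[OF setsP t, of "{2..m}" m X]
        by (simp add: S_def marginal_def)
    qed
  qed
  \<comment> \<open>The exchange needs a jointly measurable condition, hence it is made for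
    \<open>\<psi>\<close> and not for the supremum.\<close>
  then have "AE X in S. AE t in unit_lborel. \<psi> (t, X) \<le> ennreal (C / real m)"
    using TS.AE_commute[of "\<lambda>t X. \<psi> (t, X) \<le> ennreal (C / real m)"] \<psi>(1) by simp
  then have "AE X in S. (SUP x\<in>space P.
      ennreal \<bar>integrated_depth D x (empirical P {1..m} X) - integrated_depth D x (empirical P {2..m} X)\<bar>)
      \<le> ennreal (C / real m)"
    using AE_space
  proof eventually_elim
    case (elim X)
    have "(\<integral>\<^sup>+t. \<psi> (t, X) \<partial>unit_lborel) \<le> (\<integral>\<^sup>+t. ennreal (C / real m) \<partial>unit_lborel)"
      by (rule nn_integral_mono_AE[OF elim(1)])
    also have "\<dots> = ennreal (C / real m)" using T.emeasure_space_1 by simp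
    finally have le: "(\<integral>\<^sup>+t. \<psi> (t, X) \<partial>unit_lborel) \<le> ennreal (C / real m)" .
    show ?case
    proof (rule SUP_least)
      fix x assume "x \<in> space P"
      then have "x \<in> space path_space" by (simp only: sets_eq_imp_space_eq[OF setsP])
      from order_trans[OF \<psi>(3)[OF elim(2) this] le]
      show "ennreal \<bar>integrated_depth D x (empirical P {1..m} X) - integrated_depth D x (empirical P {2..m} X)\<bar>
          \<le> ennreal (C / real m)"
        by (simp only: powr_one abs_ge_zero)
    qed
  qed
  then show ?thesis by (simp only: Asm3_bound_def S_def)
qed

theorem theorem3p2:
  fixes D :: "real ^ 'd \<Rightarrow> (real ^ 'd) measure \<Rightarrow> real"
    and P :: "(real \<Rightarrow> real ^ 'd) measure"
  assumes depth: "unit_depth D"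
    and P: "P \<in> space (prob_algebra path_space)"
    and cont: "\<And>t. t \<in> {0..1} \<Longrightarrow> marginal P t \<in> continuous_distributions"
  shows "(\<forall>\<beta>. 1 / 2 < \<beta> \<and> \<beta> \<le> 1 \<longrightarrow>
            Asm2_uniform D \<beta> continuous_distributions \<longrightarrow> Asm2 (integrated_depth D) \<beta> P)
       \<and> (Asm3_uniform D continuous_distributions \<longrightarrow> Asm3 (integrated_depth D) P)"
proof (intro conjI allI impI)
  fix \<beta> :: real
  assume \<beta>: "1 / 2 < \<beta> \<and> \<beta> \<le> 1" and "Asm2_uniform D \<beta> continuous_distributions"
  then obtain C m0 where "\<forall>Q\<in>continuous_distributions. \<forall>m\<ge>m0. Asm2_bound D \<beta> Q C m"
    unfolding Asm2_uniform_def by blast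
  \<comment> \<open>Uniformity supplies one \<open>C\<close> and one \<open>m0\<close> for all
    marginals. A nonempty sample makes the empirical measure a probability measure.\<close>
  then have "Asm2_bound (integrated_depth D) \<beta> P C m" if "max m0 1 \<le> m" for m
    using \<beta> that cont by (intro Asm2_bound_integrated_depth[OF depth P]) auto
  then show "Asm2 (integrated_depth D) \<beta> P" unfolding Asm2_def by blast
next
  assume "Asm3_uniform D continuous_distributions"
  then obtain C m0 where "\<forall>Q\<in>continuous_distributions. \<forall>m\<ge>m0. Asm3_bound D Q C m"
    unfolding Asm3_uniform_def by blast
  \<comment> \<open>From size 2 on, the sample without its first observation is nonempty as
    well.\<close>
  then have "Asm3_bound (integrated_depth D) P C m" if "max m0 2 \<le> m" for m
    using that cont by (intro Asm3_bound_integrated_depth[OF depth P]) auto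
  then show "Asm3 (integrated_depth D) P" unfolding Asm3_def by blast
qed

end
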